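(* Let $m \in \mathbb{N}$ and $j\in \mathbb{N}_0$. For every integer $p$ with $0 \le p \le 2m$ we have $$K_p^{2m}(2j) = \sum_{\substack{0\le \ell\le p \\ \ell \equiv p \pmod 2}} 2^\ell \, \binom{m-\ell}{\frac{p-\ell}{2}} \; K_\ell^{m}(j).$$
   Context: $\mathbb{N}=\{1,2,\dots\}$, $\mathbb{N}_0=\{0,1,2,\dots\}$. For $x$ any number and $i\in\mathbb{N}_0$, $\binom{x}{i} = x(x-1)\cdots(x-i+1)/i!$ for $i\ge 1$ and $\binom{x}{0}=1$ (so the upper entry may be negative). The binary Krawtchouk polynomial of order $n$ and degree $p$ is $$K_p^n(x) = \sum_{i=0}^p (-1)^i \binom{x}{i}\binom{n-x}{p-i},$$ and the same formula is used to define $K_p^n(x)$ also when $p>n$ (for integers $0\le x\le n$ one then has $K_p^n(x)=0$). *)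

theory Defs
  imports Complex_Main
begin

text \<open>
  The upper entries of the binomials are ring elements and may be negative (e.g. \<open>n - x\<close> for
  \<open>x > n\<close>), hence \<open>gchoose\<close> and a subtraction carried out in \<open>'a\<close>, not in \<open>nat\<close>.
  There is no restriction \<open>p \<le> n\<close>.
\<close>

definition krawtchouk :: "nat \<Rightarrow> nat \<Rightarrow> 'a::field_char_0 \<Rightarrow> 'a" where
  "krawtchouk n p x = (\<Sum>i=0..p. (-1) ^ i * (x gchoose i) * ((of_nat n - x) gchoose (p - i)))"

end

theory Submission
  imports Defs "HOL-Computational_Algebra.Formal_Power_Series"
begin

unbundle fps_syntax

text \<open>
  The Krawtchouk values are the coefficients of the formal power series
  \<open>(1 - X)^x * (1 + X)^(n - x)\<close>. With \<open>U = 2X / (1 + X\<^sup>2)\<close> one has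
  \<open>(1 - X)\<^sup>2 = (1 + X\<^sup>2) (1 - U)\<close> and \<open>(1 + X)\<^sup>2 = (1 + X\<^sup>2) (1 + U)\<close>, so the series for \<open>(2m, 2j)\<close> is
  \<open>(1 + X\<^sup>2)^m\<close> times the series for \<open>(m, j)\<close> evaluated at \<open>U\<close>, i.e. the sum over \<open>l\<close> of
  \<open>K_l^m(j) 2^l X^l (1 + X\<^sup>2)^(m - l)\<close>.
\<close>

definition krawtchouk_fps :: "nat \<Rightarrow> 'a::field_char_0 \<Rightarrow> 'a fps" where
  "krawtchouk_fps n x = Abs_fps (\<lambda>p. krawtchouk n p x)"

text \<open>This is the Cauchy product; substituting \<open>- fps_X\<close> supplies the signs
  \<open>(-1) ^ i\<close>. Binomial series stand in for powers because the exponents may be negative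
  or non-integral.\<close>

lemma krawtchouk_fps_eq:
  "krawtchouk_fps n x = (fps_binomial x oo - fps_X) * fps_binomial (of_nat n - x)"
proof (rule fps_ext)
  fix p
  have "(fps_binomial x oo - fps_X) $ i = (-1) ^ i * (x gchoose i)" for i
    by (simp add: fps_compose_uminus')
  then show "krawtchouk_fps n x $ p =
      ((fps_binomial x oo - fps_X) * fps_binomial (of_nat n - x)) $ p"
    by (simp add: krawtchouk_fps_def krawtchouk_def fps_mult_nth)
qed

text \<open>The factor \<open>(1 + X) ^ j\<close> stands on the left because \<open>j > n\<close> is allowed.\<close>

lemma krawtchouk_fps_mult:
  "krawtchouk_fps n (of_nat j :: 'a::field_char_0) * (1 + fps_X) ^ j = (1 - fps_X) ^ j * (1 + fps_X) ^ n"
proof -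
  have "(fps_binomial (of_nat j :: 'a) oo - fps_X) = (1 - fps_X) ^ j"
    by (simp add: fps_binomial_of_nat fps_compose_power[symmetric] fps_compose_add_distrib)
  \<comment> \<open>Exponents of binomial series add, also when \<open>of_nat n - of_nat j\<close>
    is negative.\<close>
  moreover have "fps_binomial (of_nat n - of_nat j :: 'a) * (1 + fps_X) ^ j = (1 + fps_X) ^ n"
    by (simp add: fps_binomial_of_nat[symmetric] fps_binomial_add_mult[symmetric])
  ultimately show ?thesis
    by (simp add: krawtchouk_fps_eq mult.assoc)
qed

lemma krawtchouk_fps_double:
  fixes U :: "'a::field_char_0 fps"
  assumes U: "(1 + fps_X ^ 2) * U = 2 * fps_X" and U0: "U $ 0 = 0"
  shows "krawtchouk_fps (2 * m) (of_nat (2 * j)) =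
    (1 + fps_X ^ 2) ^ m * (krawtchouk_fps m (of_nat j) oo U)"
proof -
  let ?D = "1 + fps_X ^ 2 :: 'a fps" and ?F = "krawtchouk_fps m (of_nat j :: 'a)"
  have minus: "?D * (1 - U) = (1 - fps_X) ^ 2" and plus: "?D * (1 + U) = (1 + fps_X) ^ 2"
    using U by (simp_all add: ring_distribs power2_eq_square)
  have "(?F * (1 + fps_X) ^ j) oo U = ((1 - fps_X) ^ j * (1 + fps_X) ^ m) oo U"
    by (simp only: krawtchouk_fps_mult)
  then have comp: "(?F oo U) * (1 + U) ^ j = (1 - U) ^ j * (1 + U) ^ m"
    by (simp add: U0 fps_compose_mult_distrib fps_compose_power[symmetric]
        fps_compose_add_distrib fps_compose_sub_distrib)
  \<comment> \<open>By \<open>plus\<close>, \<open>(1 + fps_X) ^ (2 * j)\<close> is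
    \<open>(?D * (1 + U)) ^ j\<close>, which provides the factor \<open>(1 + U) ^ j\<close> that
    \<open>comp\<close> asks for. It is cancelled at the end.\<close>
  have "?D ^ m * (?F oo U) * (1 + fps_X) ^ (2 * j) = ?D ^ m * ?D ^ j * ((?F oo U) * (1 + U) ^ j)"
    by (simp add: power_mult plus[symmetric] power_mult_distrib)
  also have "\<dots> = (?D * (1 - U)) ^ j * (?D * (1 + U)) ^ m"
    by (simp add: comp power_mult_distrib)
  also have "\<dots> = krawtchouk_fps (2 * m) (of_nat (2 * j)) * (1 + fps_X) ^ (2 * j)"
    unfolding krawtchouk_fps_mult by (simp only: minus plus power_mult)
  finally have "?D ^ m * (?F oo U) * (1 + fps_X) ^ (2 * j) =
      krawtchouk_fps (2 * m) (of_nat (2 * j)) * (1 + fps_X) ^ (2 * j)" .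
  moreover have "(1 + fps_X :: 'a fps) \<noteq> 0"
    by (metis add.right_neutral fps_X_nth fps_add_nth fps_one_nth fps_zero_nth zero_neq_one)
  ultimately show ?thesis
    by (simp del: of_nat_mult)
qed

text \<open>Since \<open>U\<close> has no constant term, \<open>U ^ l\<close> starts in degree at
  least \<open>l\<close>. So all inner sums can run up to the same bound \<open>p\<close>, and the
  two sums can be swapped.\<close>

lemma fps_mult_compose_nth:
  fixes A F U :: "'a::field fps"
  assumes "U $ 0 = 0"
  shows "(A * (F oo U)) $ p = (\<Sum>l\<le>p. F $ l * (A * U ^ l) $ p)"
proof -
  have "(F oo U) $ k = (\<Sum>l\<le>p. F $ l * (U ^ l) $ k)" if "k \<le> p" for k
    unfolding fps_compose_nth using that assms
    by (intro sum.mono_neutral_left) (auto simp: startsby_zero_power_prefix)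
  then have "(A * (F oo U)) $ p = (\<Sum>i=0..p. A $ i * (\<Sum>l\<le>p. F $ l * (U ^ l) $ (p - i)))"
    by (simp add: fps_mult_nth)
  also have "\<dots> = (\<Sum>l\<le>p. \<Sum>i=0..p. A $ i * (F $ l * (U ^ l) $ (p - i)))"
    unfolding sum_distrib_left by (rule sum.swap)
  finally show ?thesis
    by (simp add: fps_mult_nth sum_distrib_left mult.left_commute)
qed

lemma fps_compose_X_power_nth:
  fixes F :: "'a::comm_ring_1 fps"
  assumes "d > 0"
  shows "(F oo fps_X ^ d) $ n = (if d dvd n then F $ (n div d) else 0)"
proof -
  have "(F oo fps_X ^ d) $ n = (\<Sum>i=0..n. if i = n div d then if d dvd n then F $ i else 0 else 0)"
    unfolding fps_compose_nth using assms
    by (intro sum.cong) (auto simp: power_mult[symmetric])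
  then show ?thesis
    by simp
qed

theorem theorem2p2:
  fixes m j p :: nat
  assumes "m \<ge> 1" and "p \<le> 2 * m"
  shows "krawtchouk (2 * m) p (real (2 * j)) =
    (\<Sum>l | l \<le> p \<and> l mod 2 = p mod 2.
       2 ^ l * ((real m - real l) gchoose ((p - l) div 2)) * krawtchouk m l (real j))"
proof -
  define D :: "real fps" where "D = 1 + fps_X ^ 2"
  define U where "U = 2 * fps_X * inverse D"
  have inv: "D * inverse D = 1"
    using inverse_mult_eq_1'[of D] by (simp add: D_def)
  have DU: "D * U = 2 * fps_X"
    by (simp add: U_def inv mult.left_commute)
  have U0: "U $ 0 = 0"
    by (simp add: U_def)
  \<comment> \<open>\<open>?B a\<close> plays the role of \<open>D\<close> to the power
    \<open>a\<close>; the exponent \<open>real m - real l\<close> is negative for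
    \<open>l > m\<close>.\<close>
  let ?B = "\<lambda>a::real. fps_binomial a oo fps_X ^ 2"
  have D_pow: "D ^ l = ?B (of_nat l)" for l
    by (simp add: D_def fps_binomial_of_nat fps_compose_power[symmetric] fps_compose_add_distrib)
  have pow: "D ^ m * U ^ l = 2 ^ l * fps_X ^ l * ?B (real m - real l)" for l
  proof -
    \<comment> \<open>Splitting off \<open>D ^ l\<close> clears the denominator of
      \<open>U ^ l\<close>.\<close>
    have "D ^ m = ?B (real m - real l) * D ^ l"
      by (simp add: D_pow fps_compose_mult_distrib[symmetric] fps_binomial_add_mult[symmetric])
    then have "D ^ m * U ^ l = ?B (real m - real l) * (D * U) ^ l"
      by (simp add: power_mult_distrib)
    then show ?thesis
      by (simp add: DU power_mult_distrib)
  qed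
  \<comment> \<open>The factor \<open>fps_X ^ l\<close> shifts the index to \<open>p - l\<close>,
    and a series in \<open>fps_X ^ 2\<close> has only even-degree terms; this is the source of the
    parity condition.\<close>
  have coeff: "(D ^ m * U ^ l) $ p =
      (if even (p - l) then 2 ^ l * ((real m - real l) gchoose ((p - l) div 2)) else 0)"
    if "l \<le> p" for l
  proof -
    have "2 ^ l = fps_const (2 ^ l :: real)"
      by (simp only: fps_const_power[symmetric] numeral_fps_const)
    then show ?thesis
      using that pow
      by (simp add: mult.assoc fps_compose_X_power_nth fps_X_power_mult_nth)
  qed
  have "krawtchouk (2 * m) p (real (2 * j)) = (D ^ m * (krawtchouk_fps m (real j) oo U)) $ p"
    using krawtchouk_fps_double[OF DU[unfolded D_def] U0, of m j]
    by (simp add: D_def krawtchouk_fps_def fps_eq_iff)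
  also have "\<dots> = (\<Sum>l\<le>p. krawtchouk m l (real j) * (D ^ m * U ^ l) $ p)"
    by (simp add: fps_mult_compose_nth U0 krawtchouk_fps_def)
  also have "\<dots> = (\<Sum>l | l \<le> p \<and> l mod 2 = p mod 2. krawtchouk m l (real j) * (D ^ m * U ^ l) $ p)"
    by (intro sum.mono_neutral_right) (auto simp: coeff even_diff_nat mod2_eq_if split: if_splits)
  also have "\<dots> = (\<Sum>l | l \<le> p \<and> l mod 2 = p mod 2.
       2 ^ l * ((real m - real l) gchoose ((p - l) div 2)) * krawtchouk m l (real j))"
    by (intro sum.cong) (auto simp: coeff even_diff_nat mod2_eq_if split: if_splits)
  finally show ?thesis .
qed

end
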